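(* Let $X\subset\mathbb{R}^n$ be compact and let $f,v:X\to\mathbb{R}$ be continuous. Assume there exists $\tilde x\in X$ with $v(\tilde x)<0$, and that the constraint $v(x)\le 0$ is not redundant, i.e. $\min_{x\in X}f(x)<f^\star$, where $f^\star=\min\{f(x): x\in X,\ v(x)\le 0\}$. Consider the DualBi algorithm (described in the context) run with an arbitrary input $\lambda_{\mathrm{ref}}>0$ and with arbitrary selections of minimizers $x_\lambda$. Then the first cycle terminates after a finite number $K\ge 0$ of iterations, providing a feasible solution of the primal problem $\min\{f(x):x\in X,\ v(x)\le 0\}$. Moreover, after that, either the algorithm finds (and returns) an optimal solution of the primal problem in a finite number of iterations $\bar k\ge K$, or it generates a sequence $\{\hat x(k)\}_{k\ge K}\subset X$ such that, for all $k\ge K$, $$v(\hat x(k))\le 0\qquad\text{and}\qquad f(\hat x(k+1))\le f(\hat x(k)).$$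
   Context: For $\lambda\in\mathbb{R}$ let $X(\lambda)=\arg\min_{x\in X}\{f(x)+\lambda v(x)\}$ (nonempty), and let $x_\lambda$ denote the element of $X(\lambda)$ selected by the algorithm at $\lambda$ (any choice is allowed). DualBi algorithm, input $\lambda_{\mathrm{ref}}>0$: Initialization: $k=0$, $\underline\lambda(0)=0$, $\overline\lambda(0)=\lambda_{\mathrm{ref}}$; compute $x_{\overline\lambda(0)}\in X(\overline\lambda(0))$. First cycle: while $v(x_{\overline\lambda(k)})>0$, set $\underline\lambda(k+1)=\overline\lambda(k)$, $\overline\lambda(k+1)=2\overline\lambda(k)$, compute $x_{\overline\lambda(k+1)}\in X(\overline\lambda(k+1))$, and increase $k$ by one. When the cycle ends, let $K$ be the current value of $k$ (so $K$ is the first index with $v(x_{\overline\lambda(K)})\le 0$); the feasible solution provided is $x_{\overline\lambda(K)}$. Check: if $v(x_{\overline\lambda(K)})=0$, stop and return $x_{\overline\lambda(K)}$ (in this case $\bar k=K$). Otherwise set $\hat x(K)=x_{\overline\lambda(K)}$. Second cycle (bisection), for $k=K,K+1,\dots$: set $\lambda(k)=\tfrac12(\overline\lambda(k)+\underline\lambda(k))$ and compute $x_{\lambda(k)}\in X(\lambda(k))$. - If $v(x_{\lambda(k)})=0$, stop and return $x_{\lambda(k)}$ (in this case $\bar k=k$). - If $v(x_{\lambda(k)})<0$, set $\hat x(k+1)=x_{\lambda(k)}$, $\overline\lambda(k+1)=\lambda(k)$, $\underline\lambda(k+1)=\underline\lambda(k)$. - If $v(x_{\lambda(k)})>0$, set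 $\hat x(k+1)=\hat x(k)$, $\overline\lambda(k+1)=\overline\lambda(k)$, $\underline\lambda(k+1)=\lambda(k)$. The second cycle can also be interrupted by a user-chosen stopping condition (e.g. a maximum number of iterations); the statement concerns the iterates generated when no such additional stopping condition is applied. A feasible solution is an $x\in X$ with $v(x)\le 0$; an optimal solution is a feasible $x$ with $f(x)=f^\star$. *)

theory Defs
  imports "HOL-Analysis.Analysis"
begin

definition feasible :: "'a set \<Rightarrow> ('a \<Rightarrow> real) \<Rightarrow> 'a set" where
  "feasible X v = {x \<in> X. v x \<le> 0}"

text \<open>On a nonempty compact set the infimum of a continuous function is its minimum; see
  \<open>min_value_attained\<close> below.\<close>

definition min_value :: "'a set \<Rightarrow> ('a \<Rightarrow> real) \<Rightarrow> real" where
  "min_value S g = Inf (g ` S)"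

definition primal_value :: "'a set \<Rightarrow> ('a \<Rightarrow> real) \<Rightarrow> ('a \<Rightarrow> real) \<Rightarrow> real" where
  "primal_value X f v = min_value (feasible X v) f"

definition optimal_solutions :: "'a set \<Rightarrow> ('a \<Rightarrow> real) \<Rightarrow> ('a \<Rightarrow> real) \<Rightarrow> 'a set" where
  "optimal_solutions X f v = {x \<in> feasible X v. f x = primal_value X f v}"

definition lagrangian_minimizers ::
    "'a set \<Rightarrow> ('a \<Rightarrow> real) \<Rightarrow> ('a \<Rightarrow> real) \<Rightarrow> real \<Rightarrow> 'a set" where
  "lagrangian_minimizers X f v l = {x. is_arg_min (\<lambda>x. f x + l * v x) (\<lambda>x. x \<in> X) x}"

text \<open>
  Configurations of the algorithm. \<open>First_Cycle k lo hi\<close> is the moment at which the guard of the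
  first cycle is evaluated, and \<open>Second_Cycle k lo hi xh\<close> the beginning of the bisection iteration
  \<open>k\<close>; \<open>lo\<close>, \<open>hi\<close> and \<open>xh\<close> are the lower multiplier, the upper multiplier and the current
  feasible iterate at index \<open>k\<close>. \<open>Returned k x\<close> means that the algorithm stopped at index \<open>k\<close> and
  returned \<open>x\<close>.
\<close>

datatype 'a dualbi_state =
    First_Cycle nat real real
  | Second_Cycle nat real real 'a
  | Returned nat 'a

text \<open>
  The function \<open>xs\<close> selects a minimizer \<open>xs l\<close> for every multiplier \<open>l\<close>. No multiplier is
  visited twice in a run, so this covers every way of choosing the minimizers along a run.
\<close>

fun dualbi_step :: "('a \<Rightarrow> real) \<Rightarrow> (real \<Rightarrow> 'a) \<Rightarrow> 'a dualbi_state \<Rightarrow> 'a dualbi_state" where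
  "dualbi_step v xs (First_Cycle k lo hi) =
     (if v (xs hi) > 0 then First_Cycle (Suc k) hi (2 * hi)
      else if v (xs hi) = 0 then Returned k (xs hi)
      else Second_Cycle k lo hi (xs hi))"
| "dualbi_step v xs (Second_Cycle k lo hi xh) =
     (let l = (hi + lo) / 2 in
      if v (xs l) = 0 then Returned k (xs l)
      else if v (xs l) < 0 then Second_Cycle (Suc k) lo l (xs l)
      else Second_Cycle (Suc k) l hi xh)"
| "dualbi_step v xs (Returned k x) = Returned k x"

definition dualbi_reaches ::
    "('a \<Rightarrow> real) \<Rightarrow> (real \<Rightarrow> 'a) \<Rightarrow> real \<Rightarrow> 'a dualbi_state \<Rightarrow> bool" where
  "dualbi_reaches v xs lref s \<longleftrightarrow> (\<exists>n. s = (dualbi_step v xs ^^ n) (First_Cycle 0 0 lref))"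

definition first_cycle_ends ::
    "('a \<Rightarrow> real) \<Rightarrow> (real \<Rightarrow> 'a) \<Rightarrow> real \<Rightarrow> nat \<Rightarrow> 'a \<Rightarrow> bool" where
  "first_cycle_ends v xs lref K x \<longleftrightarrow>
     (\<exists>lo hi. dualbi_reaches v xs lref (First_Cycle K lo hi) \<and> \<not> v (xs hi) > 0 \<and> x = xs hi)"

definition dualbi_returns ::
    "('a \<Rightarrow> real) \<Rightarrow> (real \<Rightarrow> 'a) \<Rightarrow> real \<Rightarrow> nat \<Rightarrow> 'a \<Rightarrow> bool" where
  "dualbi_returns v xs lref k x \<longleftrightarrow> dualbi_reaches v xs lref (Returned k x)"

definition dualbi_iterate ::
    "('a \<Rightarrow> real) \<Rightarrow> (real \<Rightarrow> 'a) \<Rightarrow> real \<Rightarrow> nat \<Rightarrow> 'a \<Rightarrow> bool" where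
  "dualbi_iterate v xs lref k x \<longleftrightarrow>
     (\<exists>lo hi. dualbi_reaches v xs lref (Second_Cycle k lo hi x))"

lemma min_value_attained:
  fixes g :: "'a::topological_space \<Rightarrow> real"
  assumes "compact S" "S \<noteq> {}" "continuous_on S g"
  shows "\<exists>x\<in>S. g x = min_value S g \<and> (\<forall>y\<in>S. min_value S g \<le> g y)"
proof -
  obtain x where x: "x \<in> S" "\<forall>y\<in>S. g x \<le> g y"
    using continuous_attains_inf[OF assms] by blast
  then have "Inf (g ` S) = g x"
    by (intro cInf_eq_minimum) auto
  with x show ?thesis
    unfolding min_value_def by auto
qed

lemma compact_feasible:
  fixes v :: "'a::heine_borel \<Rightarrow> real"
  assumes "compact X" "continuous_on X v"
  shows "compact (feasible X v)"
proof -
  have "feasible X v = X \<inter> v -` {..0}"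
    by (auto simp: feasible_def)
  moreover have "closed (X \<inter> v -` {..0})"
    using assms by (intro continuous_closed_preimage) (auto intro: compact_imp_closed)
  ultimately show ?thesis
    using assms(1) by (metis compact_Int_closed inf.left_idem)
qed

end

theory Submission
  imports Defs
begin

text \<open>
  Comparing \<open>x\<^sub>\<lambda>\<close> with a strictly feasible point shows \<open>v x\<^sub>\<lambda> \<le> 0\<close> once \<open>\<lambda>\<close> is large, so doubling
  terminates. Adding the optimality inequalities of \<open>x\<^sub>\<lambda>\<close> and \<open>x\<^sub>\<mu>\<close> shows that \<open>v x\<^sub>\<lambda>\<close> decreases
  and, for nonnegative multipliers, \<open>f x\<^sub>\<lambda>\<close> increases with \<open>\<lambda>\<close>. Bisection keeps \<open>xhat\<close> equal to the
  minimizer at the upper multiplier, which never increases, hence \<open>f xhat\<close> never increases. A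
  minimizer with \<open>v = 0\<close> is optimal by weak duality.
\<close>

lemma lagrangian_minimizersD:
  assumes "x \<in> lagrangian_minimizers X f v l"
  shows "x \<in> X" and "y \<in> X \<Longrightarrow> f x + l * v x \<le> f y + l * v y"
  using assms by (auto simp: lagrangian_minimizers_def is_arg_min_linorder)

lemma lagrangian_minimizers_antimono_constraint:
  assumes "x \<in> lagrangian_minimizers X f v l" "y \<in> lagrangian_minimizers X f v m" "l < m"
  shows "v y \<le> v x"
proof -
  have "f x + l * v x \<le> f y + l * v y" "f y + m * v y \<le> f x + m * v x"
    using assms lagrangian_minimizersD by metis+
  then have "(m - l) * v y \<le> (m - l) * v x"
    by (simp add: algebra_simps)
  with \<open>l < m\<close> show ?thesis
    by simp
qed

text \<open>Optimality of \<open>x\<close> at \<open>l\<close> gives f x \<le> f y + l * (v y - v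
  x), and the last term is nonpositive by antitonicity of the constraint value; this is where 0
  \<le> l enters.\<close>

lemma lagrangian_minimizers_mono_objective:
  assumes "x \<in> lagrangian_minimizers X f v l" "y \<in> lagrangian_minimizers X f v m" "0 \<le> l" "l < m"
  shows "f x \<le> f y"
proof -
  have "f x + l * v x \<le> f y + l * v y"
    using assms lagrangian_minimizersD by metis
  moreover have "l * v y \<le> l * v x"
    using lagrangian_minimizers_antimono_constraint[OF assms(1,2,4)] \<open>0 \<le> l\<close>
    by (rule mult_left_mono)
  ultimately show ?thesis
    by simp
qed

text \<open>For l \<ge> 0 the Lagrangian lies below \<open>f\<close> on the feasible set, and at
  \<open>x\<close> the two agree because the penalty term vanishes.\<close>

lemma lagrangian_minimizer_optimal:
  assumes "x \<in> lagrangian_minimizers X f v l" "v x = 0" "0 \<le> l"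
  shows "x \<in> optimal_solutions X f v"
proof -
  have x: "x \<in> feasible X v"
    using assms lagrangian_minimizersD(1) by (fastforce simp: feasible_def)
  have "f x \<le> f y" if "y \<in> feasible X v" for y
  proof -
    have "f x + l * v x \<le> f y + l * v y"
      using assms(1) that lagrangian_minimizersD by (fastforce simp: feasible_def)
    moreover have "l * v y \<le> 0"
      using that \<open>0 \<le> l\<close> by (auto simp: feasible_def intro: mult_nonneg_nonpos)
    ultimately show ?thesis
      using \<open>v x = 0\<close> by simp
  qed
  with x have "Inf (f ` feasible X v) = f x"
    by (intro cInf_eq_minimum) auto
  with x show ?thesis
    by (simp add: optimal_solutions_def primal_value_def min_value_def)
qed

lemma eventually_lagrangian_minimizers_feasible:
  assumes "bdd_below (f ` X)" "z \<in> X" "v z < 0"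
  shows "\<forall>\<^sub>F l in at_top. lagrangian_minimizers X f v l \<subseteq> feasible X v"
proof -
  obtain B where B: "\<And>x. x \<in> X \<Longrightarrow> B \<le> f x"
    using assms(1) by (auto simp: bdd_below_def)
  show ?thesis
    \<comment> \<open>The threshold comes from l * v x \<le> (f z - B) + l * v z, whose right-hand
      side is nonpositive once \<open>l\<close> reaches it.\<close>
    using eventually_gt_at_top[of 0] eventually_ge_at_top[of "(f z - B) / - v z"]
  proof eventually_elim
    case (elim l)
    show ?case
    proof
      fix x assume x: "x \<in> lagrangian_minimizers X f v l"
      have "f x + l * v x \<le> f z + l * v z" "B \<le> f x"
        using lagrangian_minimizersD[OF x] \<open>z \<in> X\<close> B by auto
      moreover have "f z - B \<le> l * - v z"
        using elim(2) \<open>v z < 0\<close> by (subst (asm) pos_divide_le_eq) auto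
      ultimately have "l * v x \<le> 0"
        by simp
      with \<open>0 < l\<close> have "v x \<le> 0"
        by (simp add: mult_le_0_iff)
      then show "x \<in> feasible X v"
        using lagrangian_minimizersD(1)[OF x] by (simp add: feasible_def)
    qed
  qed
qed

lemma dualbi_reaches_step:
  assumes "dualbi_reaches v xs lref s"
  shows "dualbi_reaches v xs lref (dualbi_step v xs s)"
proof -
  obtain n where "s = (dualbi_step v xs ^^ n) (First_Cycle 0 0 lref)"
    using assms by (auto simp: dualbi_reaches_def)
  then have "dualbi_step v xs s = (dualbi_step v xs ^^ Suc n) (First_Cycle 0 0 lref)"
    by simp
  then show ?thesis
    unfolding dualbi_reaches_def by blast
qed

text \<open>The lower multiplier stays existential, since it is 0 initially and half the upper one
  afterwards. Its bounds are carried along because bisection needs nonnegative, strictly nested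
  multipliers.\<close>

lemma dualbi_reaches_First_Cycle:
  assumes "lref > 0" "\<And>j. j < k \<Longrightarrow> v (xs (2 ^ j * lref)) > 0"
  shows "\<exists>lo. dualbi_reaches v xs lref (First_Cycle k lo (2 ^ k * lref))
    \<and> 0 \<le> lo \<and> lo < 2 ^ k * lref"
  using assms(2)
proof (induction k)
  case 0
  have "dualbi_reaches v xs lref (First_Cycle 0 0 lref)"
    unfolding dualbi_reaches_def by (intro exI[of _ 0]) simp
  with \<open>lref > 0\<close> show ?case
    by auto
next
  case (Suc k)
  then obtain lo where "dualbi_reaches v xs lref (First_Cycle k lo (2 ^ k * lref))"
    by auto
  from dualbi_reaches_step[OF this] Suc.prems[of k]
  have "dualbi_reaches v xs lref (First_Cycle (Suc k) (2 ^ k * lref) (2 ^ Suc k * lref))"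
    by (simp add: mult.assoc)
  with \<open>lref > 0\<close> show ?case
    by (intro exI[of _ "2 ^ k * lref"]) simp
qed

lemma dualbi_first_cycle_ends:
  assumes "lref > 0" "\<forall>\<^sub>F l in at_top. v (xs l) \<le> 0"
  shows "\<exists>K lo hi. dualbi_reaches v xs lref (First_Cycle K lo hi)
    \<and> 0 \<le> lo \<and> lo < hi \<and> v (xs hi) \<le> 0"
proof -
  obtain N where N: "\<And>l. N \<le> l \<Longrightarrow> v (xs l) \<le> 0"
    using assms(2) by (auto simp: eventually_at_top_linorder)
  obtain k where "N / lref < 2 ^ k"
    using real_arch_pow[of 2 "N / lref"] by auto
  with \<open>lref > 0\<close> have "N \<le> 2 ^ k * lref"
    by (simp add: pos_divide_less_eq)
  then have ex: "\<exists>k. v (xs (2 ^ k * lref)) \<le> 0"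
    using N by blast
  \<comment> \<open>Taking the least exponent makes the guard true at every earlier index, so the
    run really arrives at index \<open>K\<close>.\<close>
  define K where "K = (LEAST k. v (xs (2 ^ k * lref)) \<le> 0)"
  have "v (xs (2 ^ K * lref)) \<le> 0"
    unfolding K_def using ex by (rule LeastI_ex)
  moreover have "v (xs (2 ^ j * lref)) > 0" if "j < K" for j
    using not_less_Least that unfolding K_def by fastforce
  ultimately show ?thesis
    using dualbi_reaches_First_Cycle[OF \<open>lref > 0\<close>] by blast
qed

text \<open>Excluding the return of an optimal solution forces bisection to continue forever,
  because a midpoint with constraint value 0 would be returned and be optimal.\<close>

lemma dualbi_second_cycle:
  assumes xs: "\<And>l. xs l \<in> lagrangian_minimizers X f v l"
    and start: "dualbi_reaches v xs lref (Second_Cycle K lo hi (xs hi))"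
      "0 \<le> lo" "lo < hi" "v (xs hi) < 0"
    and no_return: "\<nexists>k x. K \<le> k \<and> dualbi_returns v xs lref k x \<and> x \<in> optimal_solutions X f v"
  shows "\<exists>xhat. \<forall>k\<ge>K. dualbi_iterate v xs lref k (xhat k)
    \<and> xhat k \<in> X \<and> v (xhat k) \<le> 0 \<and> f (xhat (Suc k)) \<le> f (xhat k)"
proof -
  \<comment> \<open>Invariant after \<open>n\<close> bisection steps: \<open>h\<close> is the upper
    multiplier and the current iterate is its minimizer \<open>xs h\<close>. Tracking
    \<open>h\<close> instead of the iterate makes the monotonicity of \<open>f\<close> along
    multipliers applicable.\<close>
  define P where "P n h \<longleftrightarrow> (\<exists>l. dualbi_reaches v xs lref (Second_Cycle (K + n) l h (xs h))
    \<and> 0 \<le> l \<and> l < h \<and> v (xs h) < 0)" for n h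
  have step: "\<exists>h'. P (Suc n) h' \<and> f (xs h') \<le> f (xs h)" if Pnh: "P n h" for n h
  proof -
    obtain l where l: "dualbi_reaches v xs lref (Second_Cycle (K + n) l h (xs h))"
      "0 \<le> l" "l < h" "v (xs h) < 0"
      using Pnh unfolding P_def by blast
    define m where "m = (h + l) / 2"
    have m: "l < m" "m < h"
      using \<open>l < h\<close> by (auto simp: m_def)
    note next_state = dualbi_reaches_step[OF l(1), simplified, folded m_def]
    consider "v (xs m) = 0" | "v (xs m) < 0" | "v (xs m) > 0"
      by linarith
    then show ?thesis
    proof cases
      case 1
      then have "dualbi_returns v xs lref (K + n) (xs m)"
        using next_state by (simp add: dualbi_returns_def Let_def)
      moreover have "xs m \<in> optimal_solutions X f v"
        using xs 1 by (rule lagrangian_minimizer_optimal) (use l m in simp)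
      ultimately show ?thesis
        using no_return le_add1 by blast
    next
      case 2
      then have "P (Suc n) m"
        unfolding P_def using next_state l m by (intro exI[of _ l]) (simp add: Let_def)
      moreover have "f (xs m) \<le> f (xs h)"
        using lagrangian_minimizers_mono_objective[OF xs xs] l m by simp
      ultimately show ?thesis
        by blast
    next
      case 3
      \<comment> \<open>Only the lower multiplier moves, so the iterate and its objective value are
        unchanged.\<close>
      then have "P (Suc n) h"
        unfolding P_def using next_state l m by (intro exI[of _ m]) (simp add: Let_def)
      then show ?thesis
        by blast
    qed
  qed
  have "P 0 hi"
    using start by (auto simp: P_def)
  \<comment> \<open>Dependent choice strings the single steps into one infinite sequence of upper
    multipliers, counted from 0 and hence shifted by \<open>K\<close> below.\<close>
  then obtain h where h: "\<And>n. P n (h n)" "\<And>n. f (xs (h (Suc n))) \<le> f (xs (h n))"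
    using dependent_nat_choice[of P "\<lambda>n h h'. f (xs h') \<le> f (xs h)"] step by blast
  have "dualbi_iterate v xs lref k (xs (h (k - K))) \<and> xs (h (k - K)) \<in> X
    \<and> v (xs (h (k - K))) \<le> 0 \<and> f (xs (h (Suc k - K))) \<le> f (xs (h (k - K)))" if "K \<le> k" for k
    using h(1)[of "k - K"] h(2)[of "k - K"] that lagrangian_minimizersD(1)[OF xs]
    by (auto simp: P_def dualbi_iterate_def Suc_diff_le)
  then show ?thesis
    by (intro exI[of _ "\<lambda>k. xs (h (k - K))"]) blast
qed

theorem theorem1:
  fixes X :: "(real ^ 'n) set"
    and f v :: "real ^ 'n \<Rightarrow> real"
    and xs :: "real \<Rightarrow> real ^ 'n"
    and lref :: real
  assumes "compact X"
    and "continuous_on X f"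
    and "continuous_on X v"
    and "\<exists>x\<in>X. v x < 0"
    and "min_value X f < primal_value X f v"
    and "lref > 0"
    and "\<forall>l. xs l \<in> lagrangian_minimizers X f v l"
  shows "\<exists>K x0. first_cycle_ends v xs lref K x0 \<and> x0 \<in> feasible X v \<and>
           ((\<exists>kbar\<ge>K. \<exists>x. dualbi_returns v xs lref kbar x \<and> x \<in> optimal_solutions X f v) \<or>
            (\<exists>xhat :: nat \<Rightarrow> real ^ 'n.
               (\<forall>k\<ge>K. dualbi_iterate v xs lref k (xhat k)) \<and>
               (\<forall>k\<ge>K. xhat k \<in> X \<and> v (xhat k) \<le> 0 \<and> f (xhat (Suc k)) \<le> f (xhat k))))"
proof -
  have xs: "xs l \<in> lagrangian_minimizers X f v l" for l
    using assms(7) by blast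
  obtain z where z: "z \<in> X" "v z < 0"
    using assms(4) by blast
  have "bdd_below (f ` X)"
    using assms(1,2) by (intro bounded_imp_bdd_below compact_imp_bounded compact_continuous_image)
  then have "\<forall>\<^sub>F l in at_top. lagrangian_minimizers X f v l \<subseteq> feasible X v"
    using z by (rule eventually_lagrangian_minimizers_feasible)
  then have "\<forall>\<^sub>F l in at_top. v (xs l) \<le> 0"
    by eventually_elim (use xs in \<open>auto simp: feasible_def\<close>)
  then obtain K lo hi where K: "dualbi_reaches v xs lref (First_Cycle K lo hi)"
    "0 \<le> lo" "lo < hi" "v (xs hi) \<le> 0"
    using dualbi_first_cycle_ends[OF \<open>lref > 0\<close>] by blast
  have ends: "first_cycle_ends v xs lref K (xs hi)"
    unfolding first_cycle_ends_def using K by (intro exI[of _ lo] exI[of _ hi]) simp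
  have feas: "xs hi \<in> feasible X v"
    using K lagrangian_minimizersD(1)[OF xs] by (simp add: feasible_def)
  note next_state = dualbi_reaches_step[OF K(1)]
  show ?thesis
  proof (cases "v (xs hi) = 0")
    case True
    then have "dualbi_returns v xs lref K (xs hi)"
      using next_state by (simp add: dualbi_returns_def)
    moreover have "xs hi \<in> optimal_solutions X f v"
      using xs True by (rule lagrangian_minimizer_optimal) (use K in simp)
    ultimately show ?thesis
      using ends feas by blast
  next
    case False
    with K have neg: "v (xs hi) < 0"
      by simp
    then have start: "dualbi_reaches v xs lref (Second_Cycle K lo hi (xs hi))"
      using next_state by simp
    show ?thesis
      \<comment> \<open>The premise \<open>no_return\<close> is left open here: if it fails, the
        first alternative of the goal holds, otherwise the lemma yields the second.\<close>
      using dualbi_second_cycle[OF xs start K(2,3) neg] ends feas by blast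
  qed
qed

end
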